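(* If the system of equations $A\vec{x}=\vec{b}$ is consistent, then for any $0<\omega<2$, the sequence of estimates $\vec{x}^{(n+1)}=\mathcal{Q}^\omega\vec{x}^{(n)}$ of the relaxed distributed Kaczmarz algorithm converges to the solution of minimal norm $\vec{x}^{M}=\operatorname{argmin}\{\|\vec{x}\|: A\vec{x}=\vec{b}\}$, provided the initial estimate satisfies $\vec{x}^{(0)}\in\mathcal{R}(A^* )$.
   Context: A finite tree with root $r$ and set of leaves $\mathcal{L}$ is given. Each node $v$ carries a nonzero vector $\vec{a}_v\in\mathbb{C}^d$ and a scalar $b_v\in\mathbb{C}$. $S_v:\mathbb{C}^d\to\mathbb{C}$ is $S_v\vec{z}=\vec{a}_v\cdot\vec{z}=\sum_k a_{v,k}z_k$, and $A\vec{x}=\vec{b}$ denotes the system $S_v\vec{x}=b_v$ over all nodes $v$ ($A$ is the matrix with rows $\vec{a}_v^{T}$). $\|\cdot\|$ is the Euclidean norm and $\mathcal{R}(\cdot)$ denotes range. Each edge between a node $v$ and a child $u$ of $v$ carries a weight $w(u,v)>0$, and for each non-leaf $v$ the weights over its children sum to $1$. For a leaf $\ell$, $w(\ell,r)$ is the product of the edge weights along the path from $r$ to $\ell$. The nodes on this path are denoted $r=(\ell,1),(\ell,2),\dots,(\ell,p_\ell)=\ell$. For a node $v$, $Q_v(\vec{z})=\vec{z}+S_v^*(S_vS_v^* )^{-1}(b_v-S_v\vec{z})$ is the affine orthogonal projection onto $\{S_v\vec{z}=b_v\}$, and $Q_v^\omega=(1-\omega)I+\omega Q_v$. Put $\mathcal{Q}_\ell^\omega=Q_{\ell,p_\ell}^\omega\cdots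 Q_{\ell,2}^\omega Q_{\ell,1}^\omega$ and $\mathcal{Q}^\omega=\sum_{\ell\in\mathcal{L}}w(\ell,r)\mathcal{Q}_\ell^\omega$. *)

theory Defs
  imports "HOL-Analysis.Analysis"
begin

text \<open>
  The nodes of the tree are the elements of a finite type \<open>'v\<close>; an edge \<open>(v, u) \<in> E\<close> says
  that \<open>u\<close> is a child of \<open>v\<close>. A tree path is given as the list of its nodes, downwards.
\<close>

definition tree_path :: "('v \<times> 'v) set \<Rightarrow> 'v \<Rightarrow> 'v \<Rightarrow> 'v list \<Rightarrow> bool" where
  "tree_path E v u p \<longleftrightarrow>
     p \<noteq> [] \<and> hd p = v \<and> last p = u \<and> successively (\<lambda>x y. (x, y) \<in> E) p"

text \<open>
  Since \<open>tree_path\<close> does not require distinct nodes, uniqueness also excludes cycles, edges into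
  the root, and nodes with two parents.
\<close>

definition rooted_tree :: "('v::finite \<times> 'v) set \<Rightarrow> 'v \<Rightarrow> bool" where
  "rooted_tree E r \<longleftrightarrow> (\<forall>v. \<exists>!p. tree_path E r v p)"

definition children :: "('v \<times> 'v) set \<Rightarrow> 'v \<Rightarrow> 'v set" where
  "children E v = {u. (v, u) \<in> E}"

definition leaves :: "('v \<times> 'v) set \<Rightarrow> 'v set" where
  "leaves E = {v. children E v = {}}"

definition root_path :: "('v \<times> 'v) set \<Rightarrow> 'v \<Rightarrow> 'v \<Rightarrow> 'v list" where
  "root_path E r v = (THE p. tree_path E r v p)"

text \<open>The weight of the edge between a node \<open>v\<close> and its child \<open>u\<close> is \<open>w u v\<close>.\<close>

definition edge_weights :: "('v::finite \<times> 'v) set \<Rightarrow> ('v \<Rightarrow> 'v \<Rightarrow> real) \<Rightarrow> bool" where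
  "edge_weights E w \<longleftrightarrow>
     (\<forall>v. \<forall>u\<in>children E v. 0 < w u v) \<and>
     (\<forall>v. v \<notin> leaves E \<longrightarrow> (\<Sum>u\<in>children E v. w u v) = 1)"

definition leaf_weight ::
  "('v \<times> 'v) set \<Rightarrow> 'v \<Rightarrow> ('v \<Rightarrow> 'v \<Rightarrow> real) \<Rightarrow> 'v \<Rightarrow> real" where
  "leaf_weight E r w l =
     (let p = root_path E r l in \<Prod>i<length p - 1. w (p ! Suc i) (p ! i))"

text \<open>
  The functional \<open>S a\<close> is bilinear, without conjugation, so its adjoint with respect to the
  standard Hermitian inner products carries the conjugate of \<open>a\<close> (see \<open>S_adj_adjoint\<close>).
\<close>

definition S :: "complex ^ 'd \<Rightarrow> complex ^ 'd \<Rightarrow> complex" where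
  "S a z = (\<Sum>k\<in>UNIV. a $ k * z $ k)"

definition S_adj :: "complex ^ 'd \<Rightarrow> complex \<Rightarrow> complex ^ 'd" where
  "S_adj a c = (\<chi> k. cnj (a $ k) * c)"

lemma S_adj_adjoint: "S a z * cnj c = (\<Sum>k\<in>UNIV. z $ k * cnj (S_adj a c $ k))"
  by (simp add: S_def S_adj_def sum_distrib_left mult_ac)

text \<open>
  Here \<open>inv\<close> is the inverse of the operator \<open>S S\<^sup>*\<close> on \<open>\<complex>\<close>, which is bijective for
  \<open>a \<noteq> 0\<close> by the following lemma.
\<close>

lemma S_S_adj: "(S a \<circ> S_adj a) c = of_real ((norm a)\<^sup>2) * c"
proof -
  have "(S a \<circ> S_adj a) c = (\<Sum>k\<in>UNIV. a $ k * cnj (a $ k)) * c"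
    by (simp add: S_def S_adj_def sum_distrib_right mult.assoc)
  also have "(\<Sum>k\<in>UNIV. a $ k * cnj (a $ k)) = of_real (\<Sum>k\<in>UNIV. (norm (a $ k))\<^sup>2)"
    unfolding of_real_sum complex_norm_square ..
  also have "(\<Sum>k\<in>UNIV. (norm (a $ k))\<^sup>2) = (norm a)\<^sup>2"
    by (simp add: norm_vec_def L2_set_def sum_nonneg)
  finally show ?thesis .
qed

definition Q :: "complex ^ 'd \<Rightarrow> complex \<Rightarrow> complex ^ 'd \<Rightarrow> complex ^ 'd" where
  "Q a b z = z + S_adj a (inv (S a \<circ> S_adj a) (b - S a z))"

definition Q_relaxed ::
  "real \<Rightarrow> complex ^ 'd \<Rightarrow> complex \<Rightarrow> complex ^ 'd \<Rightarrow> complex ^ 'd" where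
  "Q_relaxed \<omega> a b z = (1 - \<omega>) *\<^sub>R z + \<omega> *\<^sub>R Q a b z"

text \<open>\<open>fold\<close> applies the map of the head of the list, i.e. of the root, first.\<close>

definition Q_leaf ::
  "('v \<times> 'v) set \<Rightarrow> 'v \<Rightarrow> ('v \<Rightarrow> complex ^ 'd) \<Rightarrow> ('v \<Rightarrow> complex) \<Rightarrow> real \<Rightarrow> 'v
     \<Rightarrow> complex ^ 'd \<Rightarrow> complex ^ 'd" where
  "Q_leaf E r a b \<omega> l = fold (\<lambda>v. Q_relaxed \<omega> (a v) (b v)) (root_path E r l)"

definition Q_tree ::
  "('v::finite \<times> 'v) set \<Rightarrow> 'v \<Rightarrow> ('v \<Rightarrow> 'v \<Rightarrow> real) \<Rightarrow> ('v \<Rightarrow> complex ^ 'd) \<Rightarrow> ('v \<Rightarrow> complex)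
     \<Rightarrow> real \<Rightarrow> complex ^ 'd \<Rightarrow> complex ^ 'd" where
  "Q_tree E r w a b \<omega> z = (\<Sum>l\<in>leaves E. leaf_weight E r w l *\<^sub>R Q_leaf E r a b \<omega> l z)"

definition conj_transpose :: "complex ^ 'n ^ 'm \<Rightarrow> complex ^ 'm ^ 'n" where
  "conj_transpose A = (\<chi> i j. cnj (A $ j $ i))"

lemma matrix_rows_mult: "(\<chi> v. a v) *v x = (\<chi> v. S (a v) x)"
  by (simp add: matrix_vector_mult_def S_def)

end

theory Submission
  imports Defs
begin

text \<open>
  Subtracting a solution turns the iteration into iteration of the linear map belonging to the
  homogeneous system. A relaxed projection does not increase the norm and preserves it only on
  the kernel of its functional, because it lowers \<open>(norm z)\<^sup>2\<close> by \<open>\<omega> (2 - \<omega>) \<bar>S\<^sub>v z\<bar>\<^sup>2 / \<bar>a\<^sub>v\<bar>\<^sup>2\<close>.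
  The leaf weights are positive and sum to \<open>1\<close>, and every node lies on the path to some leaf, so
  the averaged map preserves the norm only of vectors in the kernel of \<open>A\<close>. It maps the range of
  \<open>A\<^sup>*\<close>, the orthogonal complement of that kernel, into itself, so by compactness of the unit sphere
  it is a contraction there.
\<close>

section \<open>Trees\<close>

lemma root_path_unique:
  assumes "rooted_tree E r" "tree_path E r v p"
  shows "root_path E r v = p"
  using assms unfolding rooted_tree_def root_path_def by (metis the_equality)

lemma tree_path_root_path:
  assumes "rooted_tree E r"
  shows "tree_path E r v (root_path E r v)"
  using assms root_path_unique unfolding rooted_tree_def by metis

lemma root_path_root: "rooted_tree E r \<Longrightarrow> root_path E r r = [r]"
  by (rule root_path_unique) (simp_all add: tree_path_def)

lemma root_path_child:
  assumes "rooted_tree E r" "(v, u) \<in> E"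
  shows "root_path E r u = root_path E r v @ [u]"
  using tree_path_root_path[OF assms(1), of v] assms
  by (intro root_path_unique) (auto simp: tree_path_def successively_append_iff)

text \<open>Two parents of \<open>u\<close> would have the same root path, namely that of
  \<open>u\<close> without its last node, and a root path determines its end. This lets a sum over
  edges be rewritten as a sum over the nodes other than \<open>r\<close>.\<close>

lemma bij_betw_snd_edges:
  assumes t: "rooted_tree E r"
  shows "bij_betw snd E (UNIV - {r})"
proof (rule bij_betw_imageI)
  show "inj_on snd E"
  proof (rule inj_onI, clarsimp)
    fix v v' u assume "(v, u) \<in> E" "(v', u) \<in> E"
    then have "root_path E r v = root_path E r v'"
      using root_path_child[OF t] by (metis append1_eq_conv)
    then show "v = v'"
      using tree_path_root_path[OF t] unfolding tree_path_def by metis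
  qed
  have "u \<noteq> r" if "(v, u) \<in> E" for v u
    using root_path_child[OF t that] root_path_root[OF t] tree_path_root_path[OF t, of v]
    by (auto simp: tree_path_def)
  moreover have "u \<in> snd ` E" if "u \<noteq> r" for u
  proof -
    define p where "p = butlast (root_path E r u)"
    have tp: "tree_path E r u (root_path E r u)" by (rule tree_path_root_path[OF t])
    then have eq: "root_path E r u = p @ [u]"
      unfolding p_def tree_path_def by (metis append_butlast_last_id)
    with tp that have "p \<noteq> []" by (auto simp: tree_path_def)
    with tp eq have "(last p, u) \<in> E" by (auto simp: tree_path_def successively_append_iff)
    then show ?thesis by force
  qed
  ultimately show "snd ` E = UNIV - {r}" by force
qed

text \<open>Among the nodes whose root path passes through \<open>v\<close>, one with the longest
  root path must be a leaf, since a child would have a longer such path.\<close>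

lemma leaf_below:
  assumes t: "rooted_tree E r"
  shows "\<exists>l\<in>leaves E. v \<in> set (root_path E r l)"
proof -
  let ?D = "{u. v \<in> set (root_path E r u)}"
  have "v \<in> ?D"
    using tree_path_root_path[OF t, of v] unfolding tree_path_def
    by (metis last_in_set mem_Collect_eq)
  moreover have "\<forall>u. u \<in> ?D \<longrightarrow>
      length (root_path E r u) < Suc (Max (range (\<lambda>u. length (root_path E r u))))"
    by (simp add: less_Suc_eq_le)
  ultimately obtain u where u: "u \<in> ?D"
    and max: "\<And>u'. u' \<in> ?D \<Longrightarrow> length (root_path E r u') \<le> length (root_path E r u)"
    using ex_has_greatest_nat[of "\<lambda>u. u \<in> ?D" v "\<lambda>u. length (root_path E r u)"]
    by blast
  have "u \<in> leaves E"
  proof (rule ccontr)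
    assume "u \<notin> leaves E"
    then obtain u' where "(u, u') \<in> E" by (auto simp: leaves_def children_def)
    from root_path_child[OF t this] u max[of u'] show False by simp
  qed
  with u show ?thesis by auto
qed

lemma leaf_weight_child:
  assumes t: "rooted_tree E r" and e: "(v, u) \<in> E"
  shows "leaf_weight E r w u = leaf_weight E r w v * w u v"
proof -
  define p where "p = root_path E r v"
  have "p \<noteq> []" "last p = v"
    using tree_path_root_path[OF t, of v] by (auto simp: tree_path_def p_def)
  then obtain n where n: "length p = Suc n" by (cases p) auto
  then have "p ! n = v" using \<open>last p = v\<close> \<open>p \<noteq> []\<close> by (simp add: last_conv_nth)
  moreover have "(\<Prod>i<n. w ((p @ [u]) ! Suc i) ((p @ [u]) ! i)) = (\<Prod>i<n. w (p ! Suc i) (p ! i))"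
    by (rule prod.cong) (auto simp: nth_append n)
  ultimately show ?thesis
    unfolding leaf_weight_def root_path_child[OF t e] p_def[symmetric] Let_def
    using n by (simp add: nth_append)
qed

lemma leaf_weight_pos:
  assumes t: "rooted_tree E r" and w: "edge_weights E w"
  shows "0 < leaf_weight E r w v"
proof -
  have "successively (\<lambda>x y. (x, y) \<in> E) (root_path E r v)"
    using tree_path_root_path[OF t] by (auto simp: tree_path_def)
  then show ?thesis
    using w unfolding leaf_weight_def Let_def edge_weights_def children_def
    by (intro prod_pos) (auto simp: successively_conv_nth)
qed

text \<open>
  The weight of an inner node is the sum of the weights of its children. Summing over all inner
  nodes counts each node except \<open>r\<close> once as a child.
\<close>

lemma sum_leaf_weight:
  assumes t: "rooted_tree E r" and w: "edge_weights E w"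
  shows "(\<Sum>l\<in>leaves E. leaf_weight E r w l) = 1"
proof -
  let ?W = "leaf_weight E r w"
  have "(\<Sum>u\<in>UNIV - {r}. ?W u) = (\<Sum>e\<in>E. ?W (snd e))"
    by (rule sum.reindex_bij_betw[OF bij_betw_snd_edges[OF t], symmetric])
  \<comment> \<open>No edge starts at a leaf, so the edges can be grouped by their inner
    parent.\<close>
  also have "\<dots> = (\<Sum>e\<in>Sigma (- leaves E) (children E). ?W (snd e))"
    by (rule sum.cong) (auto simp: leaves_def children_def)
  also have "\<dots> = (\<Sum>v\<in>- leaves E. \<Sum>u\<in>children E v. ?W u)"
    by (subst sum.Sigma) (auto simp: case_prod_beta)
  also have "\<dots> = (\<Sum>v\<in>- leaves E. ?W v)"
  proof (rule sum.cong[OF refl])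
    fix v assume v: "v \<in> - leaves E"
    have "(\<Sum>u\<in>children E v. ?W u) = (\<Sum>u\<in>children E v. ?W v * w u v)"
      by (rule sum.cong) (auto simp: children_def leaf_weight_child[OF t])
    also have "\<dots> = ?W v"
      using v w by (auto simp: sum_distrib_left[symmetric] edge_weights_def)
    finally show "(\<Sum>u\<in>children E v. ?W u) = ?W v" .
  qed
  also have "\<dots> = (\<Sum>v\<in>UNIV. ?W v) - (\<Sum>l\<in>leaves E. ?W l)"
    by (simp add: Compl_eq_Diff_UNIV sum_diff)
  \<comment> \<open>The total over all nodes occurs on both sides and cancels.\<close>
  finally have "(\<Sum>l\<in>leaves E. ?W l) = ?W r"
    by (simp add: sum_diff)
  also have "?W r = 1"
    by (simp add: leaf_weight_def root_path_root[OF t])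
  finally show ?thesis .
qed

section \<open>Relaxed projections\<close>

lemma S_add: "S a (y + z) = S a y + S a z"
  by (simp add: S_def sum.distrib distrib_left)

lemma S_scaleR: "S a (c *\<^sub>R z) = c *\<^sub>R S a z"
  by (simp add: S_def scaleR_sum_right)

lemma S_diff: "S a (y - z) = S a y - S a z"
  by (simp add: S_def sum_subtractf right_diff_distrib)

lemma S_adj_add: "S_adj a (c + d) = S_adj a c + S_adj a d"
  by (simp add: S_adj_def vec_eq_iff distrib_left)

lemma S_adj_scaleR: "S_adj a (c *\<^sub>R d) = c *\<^sub>R S_adj a d"
  by (simp add: S_adj_def vec_eq_iff)

text \<open>\<open>inner\<close> is the real part of the Hermitian product, so the complex adjoint
  is also the adjoint for the real inner product. All later orthogonality arguments use this real
  structure.\<close>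

lemma inner_S_adj: "inner z (S_adj a c) = inner (S a z) c"
proof -
  have re: "inner x y = Re (x * cnj y)" for x y :: complex
    by (simp add: inner_complex_def)
  show ?thesis
    unfolding inner_vec_def re S_adj_adjoint by simp
qed

lemma norm_S_adj_power2: "(norm (S_adj a c))\<^sup>2 = (norm a)\<^sup>2 * (norm c)\<^sup>2"
proof -
  have "(norm (S_adj a c))\<^sup>2 = inner (S a (S_adj a c)) c"
    by (simp add: power2_norm_eq_inner inner_S_adj)
  also have "S a (S_adj a c) = (norm a)\<^sup>2 *\<^sub>R c"
    using S_S_adj[of a c] by (simp add: scaleR_conv_of_real)
  finally show ?thesis by (simp add: power2_norm_eq_inner)
qed

lemma Q_relaxed_eq:
  assumes "a \<noteq> 0"
  shows "Q_relaxed \<omega> a b z = z + (\<omega> / (norm a)\<^sup>2) *\<^sub>R S_adj a (b - S a z)"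
proof -
  have eq: "S a \<circ> S_adj a = (\<lambda>c. of_real ((norm a)\<^sup>2) * c)"
    by (rule ext) (rule S_S_adj)
  have "inv (S a \<circ> S_adj a) c = (1 / (norm a)\<^sup>2) *\<^sub>R c" for c
    unfolding eq using assms
    by (intro inv_f_eq) (auto simp: inj_on_def scaleR_conv_of_real)
  then have "Q a b z = z + (1 / (norm a)\<^sup>2) *\<^sub>R S_adj a (b - S a z)"
    by (simp only: Q_def S_adj_scaleR)
  then show ?thesis
    by (simp add: Q_relaxed_def algebra_simps)
qed

text \<open>The residual \<open>b - S a z\<close> equals \<open>- S a (z - y)\<close>, so the error
  evolves by the homogeneous map.\<close>

lemma Q_relaxed_diff:
  assumes "a \<noteq> 0" "S a y = b"
  shows "Q_relaxed \<omega> a b z - y = Q_relaxed \<omega> a 0 (z - y)"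
  using assms by (simp add: Q_relaxed_eq S_diff)

lemma linear_Q_relaxed:
  assumes "a \<noteq> 0"
  shows "linear (Q_relaxed \<omega> a 0)"
proof -
  have eq: "Q_relaxed \<omega> a 0 z = z - (\<omega> / (norm a)\<^sup>2) *\<^sub>R S_adj a (S a z)" for z
    using S_adj_scaleR[of a "-1" "S a z"] by (simp add: Q_relaxed_eq[OF assms])
  show ?thesis
    by (rule linearI) (simp_all add: eq S_add S_scaleR S_adj_add S_adj_scaleR algebra_simps)
qed

lemma norm_Q_relaxed_power2:
  assumes "a \<noteq> 0"
  shows "(norm (Q_relaxed \<omega> a 0 z))\<^sup>2 =
    (norm z)\<^sup>2 - \<omega> * (2 - \<omega>) * (norm (S a z))\<^sup>2 / (norm a)\<^sup>2"
proof -
  let ?p = "S_adj a (- S a z)" and ?k = "\<omega> / (norm a)\<^sup>2"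
  have "(norm (Q_relaxed \<omega> a 0 z))\<^sup>2 = (norm z)\<^sup>2 + 2 * ?k * inner z ?p + ?k\<^sup>2 * (norm ?p)\<^sup>2"
    by (simp add: Q_relaxed_eq[OF assms] power2_norm_eq_inner inner_add_left inner_add_right
        inner_commute)
      (simp add: power2_eq_square)
  \<comment> \<open>By adjointness the cross term \<open>inner z ?p\<close> is
    \<open>- (norm (S a z))\<^sup>2\<close>.\<close>
  also have "\<dots> = (norm z)\<^sup>2 - 2 * ?k * (norm (S a z))\<^sup>2 + ?k\<^sup>2 * ((norm a)\<^sup>2 * (norm (S a z))\<^sup>2)"
    by (simp add: norm_S_adj_power2) (simp add: inner_S_adj power2_norm_eq_inner)
  also have "\<dots> = (norm z)\<^sup>2 - \<omega> * (2 - \<omega>) * (norm (S a z))\<^sup>2 / (norm a)\<^sup>2"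
    using assms by (simp add: field_simps power2_eq_square)
  finally show ?thesis .
qed

lemma norm_Q_relaxed_le:
  assumes "a \<noteq> 0" "0 < \<omega>" "\<omega> < 2"
  shows "norm (Q_relaxed \<omega> a 0 z) \<le> norm z"
proof (rule power2_le_imp_le)
  have "0 \<le> \<omega> * (2 - \<omega>) * (norm (S a z))\<^sup>2 / (norm a)\<^sup>2"
    using assms by simp
  then show "(norm (Q_relaxed \<omega> a 0 z))\<^sup>2 \<le> (norm z)\<^sup>2"
    unfolding norm_Q_relaxed_power2[OF assms(1)] by linarith
qed simp

lemma S_eq_0_if_norm_Q_relaxed_eq:
  assumes "a \<noteq> 0" "0 < \<omega>" "\<omega> < 2" "norm (Q_relaxed \<omega> a 0 z) = norm z"
  shows "S a z = 0"
  using norm_Q_relaxed_power2[OF assms(1), of \<omega> z] assms by simp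

lemma fold_Q_relaxed_diff:
  assumes "\<And>v. a v \<noteq> 0" "\<And>v. S (a v) y = b v"
  shows "fold (\<lambda>v. Q_relaxed \<omega> (a v) (b v)) vs z - y =
    fold (\<lambda>v. Q_relaxed \<omega> (a v) 0) vs (z - y)"
  by (induction vs arbitrary: z) (simp_all add: Q_relaxed_diff assms)

lemma linear_fold:
  assumes "\<And>v. linear (f v)"
  shows "linear (fold f vs)"
proof (induction vs)
  case Nil
  show ?case by (simp add: id_def linear_ident)
next
  case (Cons v vs)
  then show ?case using linear_compose[OF assms] by (simp add: o_def)
qed

lemma norm_fold_Q_relaxed_le:
  assumes "\<And>v. a v \<noteq> 0" "0 < \<omega>" "\<omega> < 2"
  shows "norm (fold (\<lambda>v. Q_relaxed \<omega> (a v) 0) vs z) \<le> norm z"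
proof (induction vs arbitrary: z)
  case (Cons v vs)
  show ?case
    using order_trans[OF Cons.IH norm_Q_relaxed_le[OF assms]] by simp
qed simp

text \<open>The later maps cannot restore lost norm, so the first one preserves it. Then its
  functional vanishes at \<open>z\<close> and it fixes \<open>z\<close>, so the rest of the list
  starts from the same vector and the induction applies.\<close>

lemma S_eq_0_if_norm_fold_eq:
  assumes "\<And>v. a v \<noteq> 0" "0 < \<omega>" "\<omega> < 2"
    and "norm (fold (\<lambda>v. Q_relaxed \<omega> (a v) 0) vs z) = norm z" "v \<in> set vs"
  shows "S (a v) z = 0"
  using assms(4,5)
proof (induction vs)
  case (Cons u vs)
  let ?q = "Q_relaxed \<omega> (a u) 0 z"
  have "norm z \<le> norm ?q"
    using norm_fold_Q_relaxed_le[where a = a and vs = vs and z = ?q, OF assms(1-3)] Cons.prems(1)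
    by simp
  then have "norm ?q = norm z"
    using norm_Q_relaxed_le[where a = "a u" and z = z, OF assms(1-3)] by simp
  then have u: "S (a u) z = 0"
    by (rule S_eq_0_if_norm_Q_relaxed_eq[OF assms(1-3)])
  then have "?q = z"
    by (simp add: Q_relaxed_eq[OF assms(1)]) (simp add: S_adj_def zero_vec_def)
  then show ?case using Cons u by auto
qed simp

section \<open>The averaged map\<close>

lemma Q_tree_diff:
  assumes "rooted_tree E r" "edge_weights E w" "\<And>v. a v \<noteq> 0" "\<And>v. S (a v) y = b v"
  shows "Q_tree E r w a b \<omega> z - y = Q_tree E r w a (\<lambda>_. 0) \<omega> (z - y)"
proof -
  let ?W = "leaf_weight E r w"
  \<comment> \<open>As the weights sum to 1, \<open>y\<close> can be subtracted inside the average,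
    leaf by leaf.\<close>
  have "y = (\<Sum>l\<in>leaves E. ?W l *\<^sub>R y)"
    by (simp add: scaleR_sum_left[symmetric] sum_leaf_weight[OF assms(1,2)])
  then have "Q_tree E r w a b \<omega> z - y =
      Q_tree E r w a b \<omega> z - (\<Sum>l\<in>leaves E. ?W l *\<^sub>R y)"
    by simp
  also have "\<dots> = (\<Sum>l\<in>leaves E. ?W l *\<^sub>R (Q_leaf E r a b \<omega> l z - y))"
    by (simp add: Q_tree_def sum_subtractf scaleR_diff_right)
  also have "\<dots> = Q_tree E r w a (\<lambda>_. 0) \<omega> (z - y)"
    by (simp add: Q_tree_def Q_leaf_def fold_Q_relaxed_diff assms)
  finally show ?thesis .
qed

lemma linear_Q_tree:
  assumes "\<And>v. a v \<noteq> 0"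
  shows "linear (Q_tree E r w a (\<lambda>_. 0) \<omega>)"
  unfolding Q_tree_def Q_leaf_def
  by (intro linear_compose_sum ballI linear_compose_scale_right linear_fold linear_Q_relaxed assms)

text \<open>The path to some leaf below \<open>v\<close> strictly shrinks \<open>z\<close>. That
  leaf has positive weight and no other path increases the norm, so the average is strictly
  shorter.\<close>

lemma norm_Q_tree_less:
  assumes "rooted_tree E r" "edge_weights E w" and a: "\<And>v. a v \<noteq> 0" "0 < \<omega>" "\<omega> < 2"
    and v: "S (a v) z \<noteq> 0"
  shows "norm (Q_tree E r w a (\<lambda>_. 0) \<omega> z) < norm z"
proof -
  let ?W = "leaf_weight E r w" and ?Q = "Q_leaf E r a (\<lambda>_. 0) \<omega>"
  have W: "0 < ?W l" for l by (rule leaf_weight_pos[OF assms(1,2)])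
  have le: "norm (?Q l z) \<le> norm z" for l
    unfolding Q_leaf_def by (rule norm_fold_Q_relaxed_le[OF a])
  obtain l where l: "l \<in> leaves E" "v \<in> set (root_path E r l)"
    using leaf_below[OF assms(1)] by blast
  have "norm (?Q l z) \<noteq> norm z"
    using S_eq_0_if_norm_fold_eq[where a = a, OF a _ l(2)] v unfolding Q_leaf_def by blast
  with le have less: "norm (?Q l z) < norm z" by (simp add: less_le)
  have "norm (Q_tree E r w a (\<lambda>_. 0) \<omega> z) \<le> (\<Sum>l\<in>leaves E. ?W l * norm (?Q l z))"
    unfolding Q_tree_def
    by (rule order_trans[OF norm_sum]) (simp add: W abs_of_pos)
  also have "\<dots> < (\<Sum>l\<in>leaves E. ?W l * norm z)"
    using l(1) less le W by (intro sum_strict_mono_ex1) (auto intro!: mult_left_mono less_imp_le)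
  also have "\<dots> = norm z"
    by (simp add: sum_distrib_right[symmetric] sum_leaf_weight[OF assms(1,2)])
  finally show ?thesis .
qed

text \<open>Each relaxed projection only adds a real multiple of a vector
  \<open>S_adj (a v) c\<close>.\<close>

lemma Q_tree_in_subspace:
  assumes "subspace V" "\<And>v. a v \<noteq> 0" "\<And>v c. S_adj (a v) c \<in> V" "z \<in> V"
  shows "Q_tree E r w a b \<omega> z \<in> V"
proof -
  have "fold (\<lambda>v. Q_relaxed \<omega> (a v) (b v)) vs z \<in> V" if "z \<in> V" for vs z
    using that
    by (induction vs arbitrary: z)
      (simp_all add: Q_relaxed_eq assms(2,3) subspace_add[OF assms(1)] subspace_scale[OF assms(1)])
  then show ?thesis
    unfolding Q_tree_def Q_leaf_def
    using assms by (intro subspace_sum subspace_scale) auto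
qed

lemma linear_norm_decreasing_contraction:
  fixes L :: "'a::euclidean_space \<Rightarrow> 'a"
  assumes "linear L" "subspace V" and dec: "\<And>z. z \<in> V \<Longrightarrow> z \<noteq> 0 \<Longrightarrow> norm (L z) < norm z"
  obtains c where "0 \<le> c" "c < 1" "\<And>z. z \<in> V \<Longrightarrow> norm (L z) \<le> c * norm z"
proof (cases "V \<subseteq> {0}")
  \<comment> \<open>Here the unit sphere of \<open>V\<close> is empty and has no maximum to offer,
    but the factor 0 works.\<close>
  case True
  then show ?thesis using that[of 0] linear_0[OF assms(1)] by auto
next
  case False
  let ?K = "sphere 0 1 \<inter> V"
  have unit: "z /\<^sub>R norm z \<in> ?K" if "z \<in> V" "z \<noteq> 0" for z
    using that subspace_scale[OF assms(2)] by auto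
  with False have "?K \<noteq> {}" by blast
  moreover have "compact ?K"
    by (intro compact_Int_closed compact_sphere closed_subspace assms)
  moreover have "continuous_on ?K (\<lambda>z. norm (L z))"
    by (intro continuous_intros linear_continuous_on linear_conv_bounded_linear[THEN iffD1] assms)
  ultimately have "\<exists>u\<in>?K. \<forall>z\<in>?K. norm (L z) \<le> norm (L u)"
    by (intro continuous_attains_sup)
  then obtain u where u: "u \<in> ?K" and max: "\<And>z. z \<in> ?K \<Longrightarrow> norm (L z) \<le> norm (L u)"
    by blast
  show ?thesis
  \<comment> \<open>The factor is the maximum of \<open>norm (L z)\<close> over the unit sphere of
    \<open>V\<close>; scaling extends the bound to all of \<open>V\<close>.\<close>
  proof (rule that[of "norm (L u)"])
    show "norm (L u) < 1" using dec[of u] u by (cases "u = 0") auto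
    show "norm (L z) \<le> norm (L u) * norm z" if "z \<in> V" for z
    proof (cases "z = 0")
      case True
      then show ?thesis using linear_0[OF assms(1)] by simp
    next
      case False
      then show ?thesis
        using max[OF unit[OF that False]]
        by (simp add: linear_scale[OF assms(1)] field_simps)
    qed
  qed simp
qed

lemma linear_norm_decreasing_tendsto_0:
  fixes L :: "'a::euclidean_space \<Rightarrow> 'a"
  assumes "linear L" "subspace V" "\<And>z. z \<in> V \<Longrightarrow> z \<noteq> 0 \<Longrightarrow> norm (L z) < norm z"
    and inv: "\<And>z. z \<in> V \<Longrightarrow> L z \<in> V"
    and e0: "e 0 \<in> V" and step: "\<And>n. e (Suc n) = L (e n)"
  shows "e \<longlonglongrightarrow> 0"
proof -
  obtain c where c: "0 \<le> c" "c < 1" "\<And>z. z \<in> V \<Longrightarrow> norm (L z) \<le> c * norm z"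
    using linear_norm_decreasing_contraction[OF assms(1-3)] by blast
  have eV: "e n \<in> V" for n
    by (induction n) (simp_all add: e0 step inv)
  have "norm (e n) \<le> norm (e 0) * c ^ n" for n
  proof (induction n)
    case (Suc n)
    have "norm (e (Suc n)) \<le> c * norm (e n)" using c(3)[OF eV] by (simp add: step)
    also have "\<dots> \<le> c * (norm (e 0) * c ^ n)" using Suc c(1) by (rule mult_left_mono)
    finally show ?case by (simp add: mult_ac)
  qed simp
  moreover have "(\<lambda>n. norm (e 0) * c ^ n) \<longlonglongrightarrow> 0"
    using c(1,2) by (intro tendsto_mult_right_zero LIMSEQ_power_zero) simp
  ultimately show ?thesis
    by (intro Lim_null_comparison[of e "\<lambda>n. norm (e 0) * c ^ n"]) simp_all
qed

section \<open>The minimal norm solution\<close>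

lemma conj_transpose_rows_mult:
  "conj_transpose (\<chi> v. a v) *v y = (\<Sum>v\<in>UNIV. S_adj (a v) (y $ v))"
  by (simp add: vec_eq_iff matrix_vector_mult_def conj_transpose_def S_adj_def sum_component)

lemma inner_conj_transpose:
  fixes A :: "complex ^ 'd ^ 'v"
  shows "inner z (conj_transpose A *v y) = inner (A *v z) y"
proof -
  have "inner z (conj_transpose (\<chi> v. A $ v) *v y) = inner ((\<chi> v. A $ v) *v z) y"
    unfolding conj_transpose_rows_mult matrix_rows_mult
    by (simp add: inner_sum_right inner_S_adj) (simp add: inner_vec_def)
  then show ?thesis by simp
qed

lemma subspace_range_conj_transpose: "subspace (range (\<lambda>y. conj_transpose A *v y))"
proof -
  have "linear (\<lambda>y. conj_transpose A *v y)"
    by (rule linearI)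
      (simp_all add: vec_eq_iff matrix_vector_mult_def scaleR_sum_right distrib_left sum.distrib)
  then show ?thesis by (intro linear_subspace_image subspace_UNIV)
qed

text \<open>The preimage is the vector with entry \<open>c\<close> at \<open>v\<close> and 0
  elsewhere, which selects one term of the sum over nodes.\<close>

lemma S_adj_in_range_conj_transpose:
  "S_adj (a v) c \<in> range (\<lambda>y. conj_transpose (\<chi> v. a v) *v y)"
proof (rule range_eqI)
  have "(\<Sum>u\<in>UNIV. S_adj (a u) (axis v c $ u)) = (\<Sum>u\<in>{v}. S_adj (a u) (axis v c $ u))"
    by (rule sum.mono_neutral_right) (auto simp: axis_def S_adj_def vec_eq_iff)
  then show "S_adj (a v) c = conj_transpose (\<chi> v. a v) *v axis v c"
    by (simp add: conj_transpose_rows_mult axis_def)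
qed

text \<open>Both directions are adjointness; for the converse, test with the image of
  \<open>A *v z\<close>.\<close>

lemma mult_eq_0_iff_orthogonal:
  "A *v z = 0 \<longleftrightarrow> (\<forall>u\<in>range (\<lambda>y. conj_transpose A *v y). inner z u = 0)"
  using inner_eq_zero_iff[of "A *v z"]
  by (auto simp: inner_conj_transpose simp del: inner_eq_zero_iff)

lemma solution_in_range_conj_transpose:
  fixes A :: "complex ^ 'd ^ 'v"
  assumes "A *v z = c"
  obtains y where "y \<in> range (\<lambda>y. conj_transpose A *v y)" "A *v y = c"
proof -
  let ?V = "range (\<lambda>y. conj_transpose A *v y)"
  have span: "span ?V = ?V"
    by (rule span_eq_iff[THEN iffD2, OF subspace_range_conj_transpose])
  obtain y k where "y \<in> ?V" and k: "\<And>u. u \<in> ?V \<Longrightarrow> orthogonal k u" and z: "z = y + k"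
    using orthogonal_subspace_decomp_exists[of ?V z] unfolding span by blast
  have "A *v k = 0"
    unfolding mult_eq_0_iff_orthogonal using k by (auto simp: orthogonal_def)
  with assms z have "A *v y = c" by (simp add: matrix_vector_right_distrib)
  with \<open>y \<in> ?V\<close> show ?thesis by (rule that)
qed

text \<open>Two solutions differ by a kernel vector, which is orthogonal to \<open>y\<close>, so
  Pythagoras applies.\<close>

lemma norm_solution_less:
  fixes A :: "complex ^ 'd ^ 'v"
  assumes "y \<in> range (\<lambda>y. conj_transpose A *v y)" "A *v y = c" "A *v z = c" "z \<noteq> y"
  shows "norm y < norm z"
proof -
  have "A *v (z - y) = 0"
    using assms by (simp add: matrix_vector_mult_diff_distrib)
  then have "orthogonal y (z - y)"
    using assms(1) by (auto simp: mult_eq_0_iff_orthogonal orthogonal_def inner_commute)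
  then have "(norm (y + (z - y)))\<^sup>2 = (norm y)\<^sup>2 + (norm (z - y))\<^sup>2"
    by (rule norm_add_Pythagorean)
  then have "(norm y)\<^sup>2 < (norm z)\<^sup>2" using assms(4) by simp
  then show ?thesis by (rule power2_less_imp_less) simp
qed

theorem theorem4:
  fixes E :: "('v::finite \<times> 'v) set" and r :: 'v
    and w :: "'v \<Rightarrow> 'v \<Rightarrow> real"
    and a :: "'v \<Rightarrow> complex ^ 'd" and b :: "'v \<Rightarrow> complex"
    and A :: "complex ^ 'd ^ 'v" and bvec :: "complex ^ 'v"
    and \<omega> :: real and x :: "nat \<Rightarrow> complex ^ 'd"
  assumes tree: "rooted_tree E r"
    and weights: "edge_weights E w"
    and nonzero: "\<And>v. a v \<noteq> 0"
    and A_def: "A = (\<chi> v. a v)" and bvec_def: "bvec = (\<chi> v. b v)"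
    and consistent: "\<exists>z. A *v z = bvec"
    and relaxation: "0 < \<omega>" "\<omega> < 2"
    and initial: "x 0 \<in> range (\<lambda>y. conj_transpose A *v y)"
    and iteration: "\<And>n. x (Suc n) = Q_tree E r w a b \<omega> (x n)"
  shows "(\<exists>!xM. is_arg_min norm (\<lambda>z. A *v z = bvec) xM) \<and>
    x \<longlonglongrightarrow> arg_min norm (\<lambda>z. A *v z = bvec)"
proof -
  let ?V = "range (\<lambda>y. conj_transpose A *v y)" and ?P = "\<lambda>z. A *v z = bvec"
  let ?L = "Q_tree E r w a (\<lambda>_. 0) \<omega>"
  obtain y where y: "y \<in> ?V" "?P y"
    using consistent solution_in_range_conj_transpose by blast
  have uniq: "is_arg_min norm ?P z \<longleftrightarrow> z = y" for z
    using norm_solution_less[OF y] y(2) unfolding is_arg_min_def by (metis less_asym)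
  \<comment> \<open>\<open>arg_min\<close> is a choice among minimizers, so uniqueness determines
    its value.\<close>
  then have argmin: "arg_min norm ?P = y"
    by (simp add: arg_min_def)
  have Sy: "S (a v) y = b v" for v
    using y(2) unfolding A_def bvec_def matrix_rows_mult by (simp add: vec_eq_iff)
  have sub: "subspace ?V" by (rule subspace_range_conj_transpose)
  have "(\<lambda>n. x n - y) \<longlonglongrightarrow> 0"
  proof (rule linear_norm_decreasing_tendsto_0[OF linear_Q_tree[OF nonzero] sub])
    show "norm (?L z) < norm z" if "z \<in> ?V" "z \<noteq> 0" for z
    proof -
      \<comment> \<open>Otherwise \<open>z\<close>, lying in \<open>?V\<close>, would be orthogonal
        to itself.\<close>
      have "A *v z \<noteq> 0"
        using that mult_eq_0_iff_orthogonal[of A z] inner_eq_zero_iff by blast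
      then obtain v where "S (a v) z \<noteq> 0"
        unfolding A_def matrix_rows_mult by (auto simp: vec_eq_iff)
      then show ?thesis by (rule norm_Q_tree_less[OF tree weights nonzero relaxation])
    qed
    show "?L z \<in> ?V" if "z \<in> ?V" for z
      using that S_adj_in_range_conj_transpose[of a]
      by (intro Q_tree_in_subspace sub nonzero) (auto simp: A_def)
    \<comment> \<open>The hypothesis on the initial estimate enters here: it places the first error
      in the subspace on which \<open>?L\<close> contracts.\<close>
    show "x 0 - y \<in> ?V" by (rule subspace_diff[OF sub initial y(1)])
    show "x (Suc n) - y = ?L (x n - y)" for n
      unfolding iteration by (rule Q_tree_diff[OF tree weights nonzero Sy])
  qed
  then have "x \<longlonglongrightarrow> y" by (simp add: LIM_zero_iff)
  with uniq argmin show ?thesis by simp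
qed

end
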